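(* Let $n$ be a positive integer, let $\{y_I\}$ be a collection of nonnegative real numbers indexed by the nonempty subsets $I\subseteq[n]$, and let $B=\{I\mid y_I>0\}$. Assume that $B$ is a building set on $[n]$. Then the poset of (nonempty) faces of the generalized permutohedron $P_n^y(\{y_I\})$, ordered by reverse inclusion, is isomorphic to the nested complex $\mathcal{N}(B)$.
   Context: $[n]=\{1,\dots,n\}$. For nonempty $I\subseteq[n]$, $\Delta_I=\mathrm{ConvexHull}(e_i\mid i\in I)\subset\mathbb{R}^n$, where $e_1,\dots,e_n$ are the coordinate vectors. The generalized permutohedron is the Minkowski sum $P_n^y(\{y_I\})=\sum_{\emptyset\ne I\subseteq[n]}y_I\,\Delta_I$. The polytope itself counts as a face. A set $B$ of nonempty subsets of a finite set $S$ is a building set on $S$ if: (B1) if $I,J\in B$ and $I\cap J\ne\emptyset$, then $I\cup J\in B$; (B2) $B$ contains all singletons $\{i\}$, $i\in S$. Let $B_{\max}\subseteq B$ be the set of elements of $B$ that are maximal by inclusion. A subset $N\subseteq B$ is called a nested set if: (N1) for any $I,J\in N$, either $I\subseteq J$, or $J\subseteq I$, or $I$ and $J$ are disjoint; (N2) for any collection of $k\ge2$ (pairwise) disjoint subsets $J_1,\dots,J_k\in N$, their union $J_1\cup\cdots\cup J_k$ is not in $B$; (N3) $N$ contains all elements of $B_{\max}$. The nested complex $\mathcal{N}(B)$ is the poset of all nested sets in $B$ ordered by inclusion. *)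

theory Defs
  imports "HOL-Analysis.Analysis" "HOL-Library.Set_Algebras"
begin

text \<open>
  The set $[n]$ is rendered as an arbitrary finite type \<open>'n\<close>, so that $\mathbb{R}^n$ is
  \<open>real^'n\<close> and the coordinate vector $e_i$ is \<open>axis i 1\<close>.
\<close>

definition coord_simplex :: "'n set \<Rightarrow> (real^'n::finite) set" where
  "coord_simplex I = convex hull ((\<lambda>i. axis i 1) ` I)"

text \<open>
  The sum is the sum of sets of \<open>HOL-Library.Set_Algebras\<close>, i.e. the Minkowski sum; its neutral
  element is \<open>{0}\<close>. The value \<open>y {}\<close> is irrelevant.
\<close>

definition gen_permutohedron :: "('n set \<Rightarrow> real) \<Rightarrow> (real^'n::finite) set" where
  "gen_permutohedron y = (\<Sum>I\<in>{I. I \<noteq> {}}. (\<lambda>x. y I *\<^sub>R x) ` coord_simplex I)"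

definition building_set :: "'a set \<Rightarrow> 'a set set \<Rightarrow> bool" where
  "building_set S B \<longleftrightarrow>
     finite S \<and>
     (\<forall>I\<in>B. I \<noteq> {} \<and> I \<subseteq> S) \<and>
     (\<forall>I\<in>B. \<forall>J\<in>B. I \<inter> J \<noteq> {} \<longrightarrow> I \<union> J \<in> B) \<and>
     (\<forall>i\<in>S. {i} \<in> B)"

definition maximal_elements :: "'a set set \<Rightarrow> 'a set set" where
  "maximal_elements B = {I \<in> B. \<forall>J\<in>B. I \<subseteq> J \<longrightarrow> J = I}"

text \<open>
  In the second condition the collection $J_1, \dots, J_k$ is given as a set \<open>C\<close> of cardinality
  $k$. Nothing is lost, since disjoint nonempty sets are distinct.
\<close>

definition nested_set :: "'a set set \<Rightarrow> 'a set set \<Rightarrow> bool" where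
  "nested_set B N \<longleftrightarrow>
     N \<subseteq> B \<and>
     (\<forall>I\<in>N. \<forall>J\<in>N. I \<subseteq> J \<or> J \<subseteq> I \<or> I \<inter> J = {}) \<and>
     (\<forall>C. C \<subseteq> N \<longrightarrow> finite C \<longrightarrow> card C \<ge> 2 \<longrightarrow> pairwise disjnt C \<longrightarrow> \<Union>C \<notin> B) \<and>
     maximal_elements B \<subseteq> N"

definition nested_complex :: "'a set set \<Rightarrow> 'a set set set" where
  "nested_complex B = {N. nested_set B N}"

definition nonempty_faces :: "'a::real_vector set \<Rightarrow> 'a set set" where
  "nonempty_faces P = {F. F face_of P \<and> F \<noteq> {}}"

definition order_isomorphic ::
  "'a set \<Rightarrow> ('a \<Rightarrow> 'a \<Rightarrow> bool) \<Rightarrow> 'b set \<Rightarrow> ('b \<Rightarrow> 'b \<Rightarrow> bool) \<Rightarrow> bool" where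
  "order_isomorphic X leX Y leY \<longleftrightarrow>
     (\<exists>f. bij_betw f X Y \<and> (\<forall>a\<in>X. \<forall>b\<in>X. leX a b \<longleftrightarrow> leY (f a) (f b)))"

end

theory Submission
  imports Defs
begin

text \<open>
  Every nonempty face of a polytope is the set where some linear functional \<open>h\<close> is maximal, and on
  the Minkowski sum this set is the sum of the faces \<open>y I \<cdot> \<Delta>(maximizers h I)\<close>. Since \<open>y I > 0\<close> exactly
  for \<open>I \<in> B\<close>, inclusion of faces amounts to inclusion of the sets \<open>maximizers h I\<close> for all \<open>I \<in> B\<close>. To
  \<open>h\<close> one attaches the nested set of all \<open>J \<in> B\<close> whose maximum of \<open>h\<close> strictly increases on passing
  to any larger member of \<open>B\<close>. It determines the maximizers: \<open>i \<in> I\<close> is a maximizer iff every member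
  containing \<open>i\<close> contains \<open>I\<close>. Conversely, a nested set \<open>N\<close> comes from the functional whose
  \<open>i\<close>-th coordinate is minus the number of members of \<open>N\<close> containing \<open>i\<close>.
\<close>

section \<open>Maximizers of a functional and building sets\<close>

definition maximizers :: "('a \<Rightarrow> real) \<Rightarrow> 'a set \<Rightarrow> 'a set" where
  "maximizers h I = {i \<in> I. \<forall>j\<in>I. h j \<le> h i}"

text \<open>For \<open>J \<subset> I\<close> the disjointness says that the maximum of
  \<open>h\<close> over \<open>I\<close> is strictly larger than the one over \<open>J\<close>.
  Maximal members of \<open>B\<close> satisfy the condition vacuously, which is (N3).\<close>

definition nested_of :: "'a set set \<Rightarrow> ('a \<Rightarrow> real) \<Rightarrow> 'a set set" where
  "nested_of B h = {J \<in> B. \<forall>I\<in>B. J \<subset> I \<longrightarrow> maximizers h I \<inter> J = {}}"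

lemma maximizers_nonempty:
  assumes "finite I" "I \<noteq> {}"
  shows "maximizers h I \<noteq> {}"
proof -
  have "Max (h ` I) \<in> h ` I" using assms by simp
  then obtain i where i: "i \<in> I" "h i = Max (h ` I)" by force
  have "h j \<le> h i" if "j \<in> I" for j using that assms i by simp
  with i show ?thesis unfolding maximizers_def by blast
qed

lemma building_set_finite: "building_set S B \<Longrightarrow> finite B"
  unfolding building_set_def by (meson PowI finite_Pow_iff finite_subset subsetI)

lemma building_set_D:
  assumes "building_set S B" "I \<in> B"
  shows "finite I" "I \<noteq> {}" "I \<subseteq> S"
  using assms unfolding building_set_def by (auto dest: finite_subset)

lemma building_set_Un:
  assumes "building_set S B" "I \<in> B" "J \<in> B" "I \<inter> J \<noteq> {}"
  shows "I \<union> J \<in> B"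
  using assms unfolding building_set_def by blast

text \<open>Members are added one at a time: each meets \<open>I\<close>, hence the union built so
  far, so (B1) applies.\<close>

lemma building_set_Union:
  assumes B: "building_set S B" and I: "I \<in> B"
    and C: "finite C" "C \<subseteq> B" "\<And>J. J \<in> C \<Longrightarrow> J \<inter> I \<noteq> {}"
  shows "I \<union> \<Union>C \<in> B"
  using C
proof (induction C rule: finite_induct)
  case empty
  then show ?case using I by simp
next
  case (insert J C)
  then have "I \<union> \<Union>C \<in> B" by auto
  moreover have "(I \<union> \<Union>C) \<inter> J \<noteq> {}" using insert.prems by auto
  ultimately have "(I \<union> \<Union>C) \<union> J \<in> B"
    using building_set_Un[OF B] insert.prems by blast
  moreover have "(I \<union> \<Union>C) \<union> J = I \<union> \<Union>(insert J C)" by auto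
  ultimately show ?case by simp
qed

lemma building_set_maximal_above:
  assumes B: "building_set S B" and I: "I \<in> B"
  obtains K where "K \<in> maximal_elements B" "I \<subseteq> K"
proof -
  obtain K where "K \<in> B" "I \<subseteq> K" "\<forall>J\<in>B. K \<subseteq> J \<longrightarrow> K = J"
    using finite_has_maximal2[OF building_set_finite[OF B] I] by blast
  then have "K \<in> maximal_elements B" unfolding maximal_elements_def by blast
  then show ?thesis using \<open>I \<subseteq> K\<close> by (rule that)
qed

lemma nested_setD:
  assumes "nested_set B N"
  shows "N \<subseteq> B"
    and "I \<in> N \<Longrightarrow> J \<in> N \<Longrightarrow> I \<subseteq> J \<or> J \<subseteq> I \<or> I \<inter> J = {}"
    and "C \<subseteq> N \<Longrightarrow> finite C \<Longrightarrow> card C \<ge> 2 \<Longrightarrow> pairwise disjnt C \<Longrightarrow> \<Union>C \<notin> B"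
    and "maximal_elements B \<subseteq> N"
  using assms unfolding nested_set_def by simp_all

section \<open>From functionals to nested sets\<close>

lemma nested_set_nested_of:
  assumes B: "building_set S B"
  shows "nested_set B (nested_of B h)"
proof -
  let ?N = "nested_of B h"
  \<comment> \<open>A maximizer of \<open>h\<close> on a union in \<open>B\<close> lies in one of
    the parts. That part is a proper subset of the union and belongs to
    \<open>nested_of B h\<close>, so it cannot contain such a maximizer. Both (N1) and (N2) reduce
    to this.\<close>
  have not_Union: "\<Union>C \<notin> B" if C: "C \<subseteq> ?N" "\<And>J. J \<in> C \<Longrightarrow> J \<noteq> \<Union>C" for C
  proof
    assume U: "\<Union>C \<in> B"
    obtain i where i: "i \<in> maximizers h (\<Union>C)"
      using maximizers_nonempty building_set_D[OF B U] by blast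
    then obtain J where "J \<in> C" "i \<in> J" unfolding maximizers_def by blast
    moreover from this have "J \<subset> \<Union>C" using C by blast
    ultimately show False using i C U unfolding nested_of_def by blast
  qed
  have N1: "I \<subseteq> J \<or> J \<subseteq> I \<or> I \<inter> J = {}" if "I \<in> ?N" "J \<in> ?N" for I J
  proof (rule ccontr)
    assume *: "\<not> ?thesis"
    then have disj: "I \<inter> J \<noteq> {}" by blast
    have "I \<union> J \<in> B" using building_set_Un[OF B _ _ disj] that unfolding nested_of_def by blast
    moreover have "\<Union>{I, J} \<notin> B"
    proof (rule not_Union)
      show "{I, J} \<subseteq> ?N" using that by blast
      show "K \<noteq> \<Union>{I, J}" if "K \<in> {I, J}" for K using that * by blast
    qed
    ultimately show False by simp
  qed
  have N2: "\<Union>C \<notin> B" if C: "C \<subseteq> ?N" "card C \<ge> 2" "pairwise disjnt C" for C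
  proof (rule not_Union[OF C(1)])
    fix J assume J: "J \<in> C"
    \<comment> \<open>Another member of \<open>C\<close> is nonempty and disjoint from
      \<open>J\<close>, so \<open>J\<close> falls short of the union.\<close>
    have "C \<noteq> {J}" using C(2) by auto
    then obtain K where K: "K \<in> C" "K \<noteq> J" using J by blast
    then have "K \<inter> J = {}" using C(3) J unfolding pairwise_def disjnt_def by blast
    moreover have "K \<noteq> {}" using building_set_D[OF B] K C(1) unfolding nested_of_def by blast
    ultimately show "J \<noteq> \<Union>C" using K by blast
  qed
  have N3: "maximal_elements B \<subseteq> ?N" unfolding nested_of_def maximal_elements_def by blast
  have sub: "?N \<subseteq> B" unfolding nested_of_def by blast
  show ?thesis
    unfolding nested_set_def using sub N3 by (intro conjI ballI allI impI N1 N2)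
qed

lemma maximizers_eq_nested_of:
  assumes B: "building_set S B" and I: "I \<in> B"
  shows "maximizers h I = {i \<in> I. \<forall>J\<in>nested_of B h. i \<in> J \<longrightarrow> I \<subseteq> J}"
proof (intro equalityI subsetI)
  fix i assume i: "i \<in> maximizers h I"
  have "I \<subseteq> J" if J: "J \<in> nested_of B h" "i \<in> J" for J
  proof (rule ccontr)
    assume not: "\<not> I \<subseteq> J"
    have iI: "i \<in> I" "\<And>j. j \<in> I \<Longrightarrow> h j \<le> h i" using i unfolding maximizers_def by auto
    have JB: "J \<in> B" using J unfolding nested_of_def by blast
    \<comment> \<open>\<open>I \<union> J\<close> strictly contains \<open>J\<close>, so its
      maximizers avoid \<open>J\<close> and lie in \<open>I\<close>. There \<open>i\<close> is at
      least as high, so \<open>i\<close> itself is one of them, although it lies in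
      \<open>J\<close>.\<close>
    have U: "I \<union> J \<in> B" using building_set_Un[OF B I JB] iI J by blast
    then have disj: "maximizers h (I \<union> J) \<inter> J = {}"
      using J not unfolding nested_of_def by blast
    obtain k where k: "k \<in> maximizers h (I \<union> J)"
      using maximizers_nonempty building_set_D[OF B U] by blast
    then have "k \<in> I" using disj unfolding maximizers_def by blast
    then have "i \<in> maximizers h (I \<union> J)"
      using k iI unfolding maximizers_def by (auto intro: order_trans)
    then show False using disj J by blast
  qed
  then show "i \<in> {i \<in> I. \<forall>J\<in>nested_of B h. i \<in> J \<longrightarrow> I \<subseteq> J}"
    using i unfolding maximizers_def by blast
next
  fix i assume i: "i \<in> {i \<in> I. \<forall>J\<in>nested_of B h. i \<in> J \<longrightarrow> I \<subseteq> J}"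
  \<comment> \<open>An inclusion-maximal member of \<open>B\<close> on which \<open>i\<close> is a
    maximizer belongs to \<open>nested_of B h\<close>: if it contained a maximizer of a larger
    \<open>K\<close>, then \<open>K\<close> would be in \<open>?A\<close> too.\<close>
  let ?A = "{J \<in> B. i \<in> J \<and> (\<forall>j\<in>J. h j \<le> h i)}"
  have "{i} \<in> ?A" using building_set_D[OF B I] B i unfolding building_set_def by auto
  moreover have "finite ?A" using building_set_finite[OF B] by simp
  ultimately obtain J where J: "J \<in> ?A" "\<forall>K\<in>?A. J \<subseteq> K \<longrightarrow> J = K"
    using finite_has_maximal2[of ?A "{i}"] by blast
  have "J \<in> nested_of B h"
  proof -
    have "maximizers h K \<inter> J = {}" if K: "K \<in> B" "J \<subset> K" for K
    proof (rule ccontr)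
      assume "maximizers h K \<inter> J \<noteq> {}"
      then obtain j where j: "j \<in> J" "\<forall>k\<in>K. h k \<le> h j" unfolding maximizers_def by blast
      then have "h j \<le> h i" using J by blast
      then have "K \<in> ?A" using K J j by (auto intro: order_trans)
      then show False using J(2) K by blast
    qed
    then show ?thesis using J unfolding nested_of_def by blast
  qed
  then have "I \<subseteq> J" using i J by blast
  then show "i \<in> maximizers h I" using i J unfolding maximizers_def by auto
qed

text \<open>A larger nested set puts more conditions on a maximizer. Conversely, smaller sets of
  maximizers meet fewer \<open>J\<close>, so more \<open>J\<close> qualify.\<close>

lemma nested_of_subset_iff:
  assumes B: "building_set S B"
  shows "nested_of B h \<subseteq> nested_of B g \<longleftrightarrow> (\<forall>I\<in>B. maximizers g I \<subseteq> maximizers h I)"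
proof
  assume "nested_of B h \<subseteq> nested_of B g"
  then show "\<forall>I\<in>B. maximizers g I \<subseteq> maximizers h I"
    by (auto simp: maximizers_eq_nested_of[OF B])
next
  assume "\<forall>I\<in>B. maximizers g I \<subseteq> maximizers h I"
  then show "nested_of B h \<subseteq> nested_of B g" unfolding nested_of_def by blast
qed

section \<open>From nested sets back to functionals\<close>

text \<open>The maximal members of \<open>N\<close> that meet but do not contain \<open>I\<close> are disjoint; if they covered
  \<open>I\<close>, their union would lie in \<open>B\<close>, against (N2).\<close>

lemma nested_set_uncovered:
  assumes B: "building_set S B" and N: "nested_set B N" and I: "I \<in> B"
  shows "\<exists>i\<in>I. \<forall>J\<in>N. i \<in> J \<longrightarrow> I \<subseteq> J"
proof (rule ccontr)
  assume neg: "\<not> ?thesis"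
  let ?A = "{J \<in> N. J \<inter> I \<noteq> {} \<and> \<not> I \<subseteq> J}"
  define C where "C = {J \<in> ?A. \<forall>K\<in>?A. J \<subseteq> K \<longrightarrow> J = K}"
  have NB: "N \<subseteq> B" using nested_setD(1)[OF N] .
  have fin: "finite ?A" using finite_subset[OF NB building_set_finite[OF B]] by simp
  then have finC: "finite C" unfolding C_def by (rule finite_subset[rotated]) blast
  have cover: "\<exists>J\<in>C. i \<in> J" if i: "i \<in> I" for i
  proof -
    obtain J0 where J0: "J0 \<in> N" "i \<in> J0" "\<not> I \<subseteq> J0" using neg i by blast
    then have "J0 \<in> ?A" using i by blast
    from finite_has_maximal2[OF fin this]
    obtain J where "J \<in> ?A" "J0 \<subseteq> J" "\<forall>K\<in>?A. J \<subseteq> K \<longrightarrow> J = K" by blast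
    then show ?thesis using J0 unfolding C_def by blast
  qed
  \<comment> \<open>By (N1) two members of \<open>C\<close> that meet are comparable, and maximality
    in \<open>?A\<close> makes them equal.\<close>
  have disj: "pairwise disjnt C"
    unfolding pairwise_def disjnt_def
  proof (intro ballI impI)
    fix J K assume "J \<in> C" "K \<in> C" "J \<noteq> K"
    then show "J \<inter> K = {}" using nested_setD(2)[OF N, of J K] unfolding C_def by blast
  qed
  \<comment> \<open>A single member covering all of \<open>I\<close> would contain \<open>I\<close>,
    which \<open>?A\<close> excludes.\<close>
  have "card C \<ge> 2"
  proof (rule ccontr)
    assume "\<not> card C \<ge> 2"
    then have "card C \<le> Suc 0" by simp
    then have one: "\<And>J K. J \<in> C \<Longrightarrow> K \<in> C \<Longrightarrow> J = K" using finC card_le_Suc0_iff_eq by blast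
    obtain i where "i \<in> I" using building_set_D[OF B I] by blast
    then obtain J where J: "J \<in> C" using cover by blast
    then have "I \<subseteq> J" using cover one by blast
    then show False using J unfolding C_def by blast
  qed
  moreover have "C \<subseteq> N" unfolding C_def by blast
  ultimately have "\<Union>C \<notin> B" using nested_setD(3)[OF N] finC disj by blast
  moreover have "I \<union> \<Union>C \<in> B"
    by (rule building_set_Union[OF B I finC]) (use NB in \<open>auto simp: C_def\<close>)
  moreover have "I \<union> \<Union>C = \<Union>C" using cover by blast
  ultimately show False by simp
qed

text \<open>Every point of \<open>I\<close> lies in all members containing \<open>I\<close>, so
  \<open>?c\<close> bounds its count from below, with equality iff no other member contains the
  point. By \<open>ex\<close> the bound is attained, so it is the minimum.\<close>

lemma maximizers_minus_card:
  assumes fin: "finite N" and ex: "\<exists>i\<in>I. \<forall>J\<in>N. i \<in> J \<longrightarrow> I \<subseteq> J"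
  shows "maximizers (\<lambda>i. - real (card {J \<in> N. i \<in> J})) I = {i \<in> I. \<forall>J\<in>N. i \<in> J \<longrightarrow> I \<subseteq> J}"
    (is "maximizers ?h I = ?M")
proof -
  let ?c = "card {J \<in> N. I \<subseteq> J}"
  have ge: "?c \<le> card {J \<in> N. i \<in> J}" if "i \<in> I" for i
    by (rule card_mono) (use fin that in auto)
  have eq: "card {J \<in> N. i \<in> J} = ?c \<longleftrightarrow> i \<in> ?M" if i: "i \<in> I" for i
  proof
    assume "card {J \<in> N. i \<in> J} = ?c"
    moreover have "{J \<in> N. I \<subseteq> J} \<subseteq> {J \<in> N. i \<in> J}" using i by blast
    ultimately have "{J \<in> N. I \<subseteq> J} = {J \<in> N. i \<in> J}" using fin by (intro card_subset_eq) auto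
    then show "i \<in> ?M" using i by blast
  next
    assume "i \<in> ?M"
    then have "{J \<in> N. I \<subseteq> J} = {J \<in> N. i \<in> J}" by blast
    then show "card {J \<in> N. i \<in> J} = ?c" by simp
  qed
  obtain k where k: "k \<in> ?M" using ex by blast
  then have kc: "k \<in> I" "card {J \<in> N. k \<in> J} = ?c" using eq by auto
  show ?thesis
  proof (intro equalityI subsetI)
    fix i assume "i \<in> maximizers ?h I"
    then have "i \<in> I" "?h k \<le> ?h i" using kc unfolding maximizers_def by auto
    then have "card {J \<in> N. i \<in> J} = ?c" using ge[of i] kc by simp
    then show "i \<in> ?M" using eq \<open>i \<in> I\<close> by blast
  next
    fix i assume i: "i \<in> ?M"
    then have "card {J \<in> N. i \<in> J} = ?c" using eq by blast
    then show "i \<in> maximizers ?h I" using i ge unfolding maximizers_def by auto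
  qed
qed

lemma nested_set_eq_nested_of:
  assumes B: "building_set S B" and N: "nested_set B N"
  shows "\<exists>h. nested_of B h = N"
proof -
  let ?h = "\<lambda>i. - real (card {J \<in> N. i \<in> J})"
  note NB = nested_setD(1)[OF N] and comp = nested_setD(2)[OF N] and maxN = nested_setD(4)[OF N]
  have fin: "finite N" using finite_subset[OF NB building_set_finite[OF B]] .
  have M: "maximizers ?h I = {i \<in> I. \<forall>J\<in>N. i \<in> J \<longrightarrow> I \<subseteq> J}" if "I \<in> B" for I
    by (rule maximizers_minus_card[OF fin nested_set_uncovered[OF B N that]])
  have "nested_of B ?h = N"
  proof (intro equalityI subsetI)
    fix J assume J: "J \<in> nested_of B ?h"
    then have JB: "J \<in> B" unfolding nested_of_def by blast
    \<comment> \<open>(N3) supplies a member of \<open>N\<close> above \<open>J\<close>; a minimal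
      one, \<open>K\<close>, will turn out to be \<open>J\<close> itself.\<close>
    obtain K0 where "K0 \<in> maximal_elements B" "J \<subseteq> K0"
      by (rule building_set_maximal_above[OF B JB])
    then have K0: "K0 \<in> {K \<in> N. J \<subseteq> K}" using maxN by blast
    have "finite {K \<in> N. J \<subseteq> K}" using fin by simp
    from finite_has_minimal2[OF this K0]
    obtain K where K: "K \<in> N" "J \<subseteq> K" "\<forall>L\<in>{K \<in> N. J \<subseteq> K}. L \<subseteq> K \<longrightarrow> K = L" by blast
    have "J = K"
    proof (rule ccontr)
      assume "J \<noteq> K"
      then have disj: "maximizers ?h K \<inter> J = {}"
        using J K NB unfolding nested_of_def by blast
      \<comment> \<open>Every member of \<open>N\<close> through this \<open>i\<close> contains
        \<open>J\<close>. As \<open>i\<close> is no maximizer on \<open>K\<close>, some such member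
        \<open>L\<close> fails to contain \<open>K\<close>; by (N1) it lies inside \<open>K\<close>,
        against minimality.\<close>
      obtain i where i: "i \<in> J" "\<forall>L\<in>N. i \<in> L \<longrightarrow> J \<subseteq> L"
        using nested_set_uncovered[OF B N JB] by blast
      then have "i \<notin> maximizers ?h K" using disj by blast
      moreover have "K \<in> B" using K NB by blast
      ultimately obtain L where L: "L \<in> N" "i \<in> L" "\<not> K \<subseteq> L" using M[of K] i K by blast
      then have "J \<subseteq> L" "L \<subseteq> K" using i comp[of L K] K by blast+
      then show False using K L by blast
    qed
    then show "J \<in> N" using K by simp
  next
    fix J assume J: "J \<in> N"
    \<comment> \<open>By \<open>M\<close>, a maximizer on \<open>I\<close> that lies in
      \<open>J\<close> would force \<open>I \<subseteq> J\<close>.\<close>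
    have "maximizers ?h I \<inter> J = {}" if "I \<in> B" "J \<subset> I" for I
      using M[OF that(1)] J that(2) by blast
    then show "J \<in> nested_of B ?h" using J NB unfolding nested_of_def by blast
  qed
  then show ?thesis by blast
qed

lemma nested_complex_eq_range:
  assumes "building_set S B"
  shows "nested_complex B = range (nested_of B)"
  using nested_set_nested_of[OF assms] nested_set_eq_nested_of[OF assms]
  unfolding nested_complex_def by blast

text \<open>\<open>p\<close> and \<open>q\<close> parametrise two posets by the same indices, as
  functionals do for faces and for nested sets. Antisymmetry turns agreement of the orders into
  agreement of equalities, so any preimage under \<open>p\<close> may define the map.\<close>

lemma order_isomorphic_range:
  assumes le: "\<And>a b. leX (p a) (p b) \<longleftrightarrow> leY (q a) (q b)"
    and X: "\<And>a b. leX (p a) (p b) \<Longrightarrow> leX (p b) (p a) \<Longrightarrow> p a = p b" "\<And>a. leX (p a) (p a)"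
    and Y: "\<And>a b. leY (q a) (q b) \<Longrightarrow> leY (q b) (q a) \<Longrightarrow> q a = q b" "\<And>a. leY (q a) (q a)"
  shows "order_isomorphic (range p) leX (range q) leY"
proof -
  have eq: "p a = p b \<longleftrightarrow> q a = q b" for a b using le X Y by metis
  define f where "f x = q (inv p x)" for x
  have f: "f (p a) = q a" for a
    unfolding f_def using eq f_inv_into_f[of "p a" p UNIV] by blast
  have "bij_betw f (range p) (range q)"
    unfolding bij_betw_def inj_on_def using f eq by (auto simp: image_image)
  moreover have "\<forall>a\<in>range p. \<forall>b\<in>range p. leX a b \<longleftrightarrow> leY (f a) (f b)" using f le by auto
  ultimately show ?thesis unfolding order_isomorphic_def by blast
qed


section \<open>Faces and Minkowski sums of polytopes\<close>

lemma nonempty_faces_polytope: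
  fixes P :: "'a::euclidean_space set"
  assumes P: "polytope P" "P \<noteq> {}"
  shows "nonempty_faces P = range (\<lambda>h. {x \<in> P. \<forall>z\<in>P. h \<bullet> z \<le> h \<bullet> x})"
proof (intro equalityI subsetI)
  fix F assume "F \<in> nonempty_faces P"
  \<comment> \<open>Faces of a polyhedron are exposed, and nonemptiness of \<open>F\<close> makes
    the bound \<open>b\<close> below an attained maximum.\<close>
  then have "F exposed_face_of P" "F \<noteq> {}"
    using exposed_face_of_polyhedron[OF polytope_imp_polyhedron[OF P(1)]]
    unfolding nonempty_faces_def by auto
  then obtain h b where hb: "P \<subseteq> {x. h \<bullet> x \<le> b}" "F = P \<inter> {x. h \<bullet> x = b}"
    unfolding exposed_face_of_def by blast
  obtain x0 where "x0 \<in> P" "h \<bullet> x0 = b" using \<open>F \<noteq> {}\<close> hb by blast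
  then have "F = {x \<in> P. \<forall>z\<in>P. h \<bullet> z \<le> h \<bullet> x}" using hb by force
  then show "F \<in> range (\<lambda>h. {x \<in> P. \<forall>z\<in>P. h \<bullet> z \<le> h \<bullet> x})" by blast
next
  fix F assume "F \<in> range (\<lambda>h. {x \<in> P. \<forall>z\<in>P. h \<bullet> z \<le> h \<bullet> x})"
  then obtain h where F: "F = {x \<in> P. \<forall>z\<in>P. h \<bullet> z \<le> h \<bullet> x}" by blast
  have "continuous_on P (\<lambda>x. h \<bullet> x)" by (intro continuous_intros)
  from continuous_attains_sup[OF polytope_imp_compact[OF P(1)] P(2) this]
  obtain x0 where x0: "x0 \<in> P" "\<And>z. z \<in> P \<Longrightarrow> h \<bullet> z \<le> h \<bullet> x0" by blast
  then have "F = P \<inter> {x. h \<bullet> x = h \<bullet> x0}" unfolding F by (auto intro: antisym)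
  then have "F face_of P"
    using face_of_Int_supporting_hyperplane_le[OF polytope_imp_convex[OF P(1)] x0(2)] by simp
  moreover have "x0 \<in> F" using x0 unfolding F by simp
  ultimately show "F \<in> nonempty_faces P" unfolding nonempty_faces_def by blast
qed

lemma polytope_set_plus:
  fixes S T :: "'a::euclidean_space set"
  assumes "polytope S" "polytope T"
  shows "polytope (S + T)"
  using assms unfolding polytope_def by (metis convex_hull_set_plus finite_set_plus)

lemma polytope_set_sum:
  fixes S :: "'i \<Rightarrow> 'a::euclidean_space set"
  shows "(\<And>i. i \<in> A \<Longrightarrow> polytope (S i)) \<Longrightarrow> polytope (\<Sum>i\<in>A. S i)"
proof (induction A rule: infinite_finite_induct)
  case (infinite A)
  then show ?case by (simp add: polytope_sing)
next
  case empty
  then show ?case by (simp add: polytope_sing)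
next
  case (insert i A)
  then show ?case by (simp add: polytope_set_plus)
qed

lemma polytope_gen_permutohedron: "polytope (gen_permutohedron y)"
  unfolding gen_permutohedron_def coord_simplex_def
proof (rule polytope_set_sum)
  fix I
  show "polytope ((\<lambda>x. y I *\<^sub>R x) ` (convex hull (\<lambda>i. axis i 1) ` I))"
    unfolding polytope_def convex_hull_scaling[symmetric] by (metis finite finite_imageI)
qed

text \<open>The points \<open>s I\<close> are kept unscaled so that their supports can be compared
  with \<open>maximizers\<close>. The decomposition of \<open>x\<close> need not be unique.\<close>

lemma mem_gen_permutohedron:
  "x \<in> gen_permutohedron y \<longleftrightarrow>
     (\<exists>s. (\<forall>I. I \<noteq> {} \<longrightarrow> s I \<in> coord_simplex I) \<and> x = (\<Sum>I | I \<noteq> {}. y I *\<^sub>R s I))"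
  (is "_ \<longleftrightarrow> ?R")
proof
  assume "x \<in> gen_permutohedron y"
  then obtain f where f: "x = (\<Sum>I | I \<noteq> {}. f I)"
    "\<And>I. I \<noteq> {} \<Longrightarrow> f I \<in> (\<lambda>x. y I *\<^sub>R x) ` coord_simplex I"
    unfolding gen_permutohedron_def by (auto simp: set_sum_alt)
  then have "\<forall>I. \<exists>s. I \<noteq> {} \<longrightarrow> s \<in> coord_simplex I \<and> f I = y I *\<^sub>R s" by blast
  then obtain s where "\<And>I. I \<noteq> {} \<Longrightarrow> s I \<in> coord_simplex I \<and> f I = y I *\<^sub>R s I" by metis
  then show ?R using f by (intro exI[of _ s]) (auto intro: sum.cong)
next
  assume ?R
  then show "x \<in> gen_permutohedron y"
    unfolding gen_permutohedron_def by (auto simp: set_sum_alt)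
qed

section \<open>Maximal faces of simplices and of their Minkowski sum\<close>

lemma coord_simplex_coords:
  fixes s :: "real^'n::finite"
  assumes "s \<in> coord_simplex I"
  shows "0 \<le> s $ i" "i \<notin> I \<Longrightarrow> s $ i = 0" "(\<Sum>i\<in>I. s $ i) = 1"
proof -
  let ?A = "{s :: real^'n. (\<forall>i. 0 \<le> s $ i) \<and> (\<forall>i. i \<notin> I \<longrightarrow> s $ i = 0) \<and> (\<Sum>i\<in>I. s $ i) = 1}"
  have "convex ?A"
    unfolding convex_def by (auto simp: sum.distrib simp flip: sum_distrib_left)
  moreover have "(\<lambda>i. axis i 1) ` I \<subseteq> ?A" by (auto simp: axis_def)
  ultimately have "coord_simplex I \<subseteq> ?A" unfolding coord_simplex_def by (rule hull_minimal[rotated])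
  then show "0 \<le> s $ i" "i \<notin> I \<Longrightarrow> s $ i = 0" "(\<Sum>i\<in>I. s $ i) = 1" using assms by blast+
qed

lemma axis_in_coord_simplex: "i \<in> I \<Longrightarrow> axis i 1 \<in> coord_simplex I"
  unfolding coord_simplex_def by (simp add: hull_inc)

text \<open>The coordinates of \<open>s\<close> are weights on \<open>I\<close> with total 1, so
  \<open>h \<bullet> s\<close> is a weighted average of \<open>h\<close>. Its gap to the maximum is
  a sum of nonnegative terms, zero iff all weight sits on maximizers.\<close>

lemma inner_coord_simplex:
  assumes s: "s \<in> coord_simplex I" and m: "m \<in> maximizers (($) h) I"
  shows "h \<bullet> s \<le> h $ m"
    and "h \<bullet> s = h $ m \<longleftrightarrow> (\<forall>i. s $ i \<noteq> 0 \<longrightarrow> i \<in> maximizers (($) h) I)"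
proof -
  note c = coord_simplex_coords[OF s]
  have mI: "m \<in> I" "\<And>i. i \<in> I \<Longrightarrow> h $ i \<le> h $ m" using m unfolding maximizers_def by auto
  have "h \<bullet> s = (\<Sum>i\<in>UNIV. h $ i * s $ i)" by (simp add: inner_vec_def)
  also have "\<dots> = (\<Sum>i\<in>I. h $ i * s $ i)" by (rule sum.mono_neutral_right) (use c in auto)
  finally have hs: "h \<bullet> s = (\<Sum>i\<in>I. h $ i * s $ i)" .
  have "h $ m = (\<Sum>i\<in>I. h $ m * s $ i)" using c(3) by (simp add: sum_distrib_left[symmetric])
  then have diff: "h $ m - h \<bullet> s = (\<Sum>i\<in>I. (h $ m - h $ i) * s $ i)"
    by (simp add: hs left_diff_distrib sum_subtractf)
  have nn: "0 \<le> (h $ m - h $ i) * s $ i" if "i \<in> I" for i using mI that c by simp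
  have "0 \<le> (\<Sum>i\<in>I. (h $ m - h $ i) * s $ i)" by (rule sum_nonneg) (rule nn)
  then show "h \<bullet> s \<le> h $ m" using diff by simp
  have "h \<bullet> s = h $ m \<longleftrightarrow> (\<Sum>i\<in>I. (h $ m - h $ i) * s $ i) = 0" using diff by auto
  also have "\<dots> \<longleftrightarrow> (\<forall>i\<in>I. (h $ m - h $ i) * s $ i = 0)" by (rule sum_nonneg_eq_0_iff) (use nn in auto)
  also have "\<dots> \<longleftrightarrow> (\<forall>i. s $ i \<noteq> 0 \<longrightarrow> i \<in> maximizers (($) h) I)"
  proof -
    have "i \<in> maximizers (($) h) I \<longleftrightarrow> h $ i = h $ m" if "i \<in> I" for i
      using that mI unfolding maximizers_def by (auto intro: antisym)
    then have "(h $ m - h $ i) * s $ i = 0 \<longleftrightarrow> (s $ i \<noteq> 0 \<longrightarrow> i \<in> maximizers (($) h) I)"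
      if "i \<in> I" for i using that by auto
    then show ?thesis using c(2) by blast
  qed
  finally show "h \<bullet> s = h $ m \<longleftrightarrow> (\<forall>i. s $ i \<noteq> 0 \<longrightarrow> i \<in> maximizers (($) h) I)" .
qed

text \<open>The maximum of \<open>h\<close> on a Minkowski sum is the sum of the maxima on the
  summands, so a point is maximal iff each of its scaled components is. Summands with
  \<open>y I = 0\<close> impose nothing. The criterion applies to every decomposition
  \<open>s\<close> of the point.\<close>

lemma gen_permutohedron_max_iff:
  fixes y :: "'n::finite set \<Rightarrow> real"
  assumes y: "\<forall>I. I \<noteq> {} \<longrightarrow> y I \<ge> 0"
    and s: "\<forall>I. I \<noteq> {} \<longrightarrow> s I \<in> coord_simplex I"
  shows "(\<forall>z\<in>gen_permutohedron y. h \<bullet> z \<le> h \<bullet> (\<Sum>I | I \<noteq> {}. y I *\<^sub>R s I)) \<longleftrightarrow>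
         (\<forall>I. I \<noteq> {} \<longrightarrow> y I > 0 \<longrightarrow> (\<forall>i. s I $ i \<noteq> 0 \<longrightarrow> i \<in> maximizers (($) h) I))"
    (is "?L \<longleftrightarrow> ?R")
proof -
  have "\<forall>I. \<exists>i. I \<noteq> {} \<longrightarrow> i \<in> maximizers (($) h) I"
    using maximizers_nonempty[OF finite] by blast
  then obtain m where m: "\<And>I. I \<noteq> {} \<Longrightarrow> m I \<in> maximizers (($) h) I" by metis
  let ?M = "\<Sum>I | I \<noteq> {}. y I * h $ m I"
  have inner: "h \<bullet> (\<Sum>I | I \<noteq> {}. y I *\<^sub>R t I) = (\<Sum>I | I \<noteq> {}. y I * (h \<bullet> t I))" for t
    by (simp add: inner_sum_right)
  have term_le: "y I * (h \<bullet> t) \<le> y I * h $ m I" if "I \<noteq> {}" "t \<in> coord_simplex I" for I t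
    using inner_coord_simplex(1)[OF that(2) m] y that by (simp add: mult_left_mono)
  have le: "h \<bullet> z \<le> ?M" if z: "z \<in> gen_permutohedron y" for z
  proof -
    obtain t where t: "\<And>I. I \<noteq> {} \<Longrightarrow> t I \<in> coord_simplex I"
      and zt: "z = (\<Sum>I | I \<noteq> {}. y I *\<^sub>R t I)"
      using z unfolding mem_gen_permutohedron by blast
    show ?thesis unfolding zt inner by (rule sum_mono) (use term_le t in simp)
  qed
  \<comment> \<open>Choosing a maximizing vertex in every summand shows that the bound
    \<open>?M\<close> is attained.\<close>
  let ?top = "\<Sum>I | I \<noteq> {}. y I *\<^sub>R (axis (m I) 1 :: real^'n)"
  have top_mem: "?top \<in> gen_permutohedron y"
    unfolding mem_gen_permutohedron using m
    by (intro exI[of _ "\<lambda>I. axis (m I) 1"]) (auto simp: maximizers_def intro: axis_in_coord_simplex)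
  have top: "h \<bullet> ?top = ?M" unfolding inner by (simp add: inner_axis)
  have mem: "(\<Sum>I | I \<noteq> {}. y I *\<^sub>R s I) \<in> gen_permutohedron y"
    unfolding mem_gen_permutohedron using s by blast
  have "?L \<longleftrightarrow> h \<bullet> (\<Sum>I | I \<noteq> {}. y I *\<^sub>R s I) = ?M"
  proof (intro iffI)
    assume ?L
    then have "h \<bullet> ?top \<le> h \<bullet> (\<Sum>I | I \<noteq> {}. y I *\<^sub>R s I)"
      using top_mem by (rule bspec)
    then show "h \<bullet> (\<Sum>I | I \<noteq> {}. y I *\<^sub>R s I) = ?M"
      using le[OF mem] unfolding top by (rule antisym[rotated])
  next
    assume "h \<bullet> (\<Sum>I | I \<noteq> {}. y I *\<^sub>R s I) = ?M"
    then show ?L using le by simp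
  qed
  also have "\<dots> \<longleftrightarrow> (\<forall>I. I \<noteq> {} \<longrightarrow> y I * (h \<bullet> s I) = y I * h $ m I)"
  proof
    assume "h \<bullet> (\<Sum>I | I \<noteq> {}. y I *\<^sub>R s I) = ?M"
    then have eq: "(\<Sum>I | I \<noteq> {}. y I * (h \<bullet> s I)) = ?M" unfolding inner .
    show "\<forall>I. I \<noteq> {} \<longrightarrow> y I * (h \<bullet> s I) = y I * h $ m I"
      using sum_mono_inv[OF eq] term_le s by simp
  next
    assume "\<forall>I. I \<noteq> {} \<longrightarrow> y I * (h \<bullet> s I) = y I * h $ m I"
    then show "h \<bullet> (\<Sum>I | I \<noteq> {}. y I *\<^sub>R s I) = ?M"
      unfolding inner by (intro sum.cong) auto
  qed
  also have "\<dots> \<longleftrightarrow> (\<forall>I. I \<noteq> {} \<longrightarrow> y I > 0 \<longrightarrow> h \<bullet> s I = h $ m I)"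
  proof -
    have "y I * (h \<bullet> s I) = y I * h $ m I \<longleftrightarrow> (y I > 0 \<longrightarrow> h \<bullet> s I = h $ m I)" if "I \<noteq> {}" for I
      using y that by (cases "y I = 0") auto
    then show ?thesis by blast
  qed
  also have "\<dots> \<longleftrightarrow> ?R"
  proof -
    have "h \<bullet> s I = h $ m I \<longleftrightarrow> (\<forall>i. s I $ i \<noteq> 0 \<longrightarrow> i \<in> maximizers (($) h) I)" if "I \<noteq> {}" for I
      by (rule inner_coord_simplex(2)) (use s m that in auto)
    then show ?thesis by simp
  qed
  finally show ?thesis .
qed

lemma gen_permutohedron_face_subset_iff:
  fixes y :: "'n::finite set \<Rightarrow> real"
  assumes y: "\<forall>I. I \<noteq> {} \<longrightarrow> y I \<ge> 0"
  shows "{x \<in> gen_permutohedron y. \<forall>z\<in>gen_permutohedron y. h \<bullet> z \<le> h \<bullet> x}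
         \<subseteq> {x \<in> gen_permutohedron y. \<forall>z\<in>gen_permutohedron y. g \<bullet> z \<le> g \<bullet> x}
         \<longleftrightarrow> (\<forall>I. I \<noteq> {} \<longrightarrow> y I > 0 \<longrightarrow> maximizers (($) h) I \<subseteq> maximizers (($) g) I)"
    (is "?F h \<subseteq> ?F g \<longleftrightarrow> ?R")
proof
  assume sub: "?F h \<subseteq> ?F g"
  show ?R
  proof (intro allI impI subsetI)
    fix I i assume I: "I \<noteq> {}" "y I > 0" and i: "i \<in> maximizers (($) h) I"
    have "\<forall>J. \<exists>j. J \<noteq> {} \<longrightarrow> j \<in> maximizers (($) h) J"
      using maximizers_nonempty[OF finite] by blast
    then obtain m where m: "\<And>J. J \<noteq> {} \<Longrightarrow> m J \<in> maximizers (($) h) J" by metis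
    \<comment> \<open>The test point takes the vertex \<open>axis i 1\<close> from the simplex of
      \<open>I\<close> and an arbitrary \<open>h\<close>-maximal vertex from every other one. It
      lies in the face of \<open>h\<close>, hence in that of \<open>g\<close>, and \<open>i\<close>
      is the only index in the support of \<open>s I\<close>.\<close>
    define s :: "'n set \<Rightarrow> real^'n" where "s J = axis ((m(I := i)) J) 1" for J
    have m': "(m(I := i)) J \<in> maximizers (($) h) J" if "J \<noteq> {}" for J using m i that by simp
    have s: "\<forall>J. J \<noteq> {} \<longrightarrow> s J \<in> coord_simplex J"
      using m' unfolding s_def maximizers_def by (blast intro: axis_in_coord_simplex)
    have supp: "s J $ j \<noteq> 0 \<longleftrightarrow> j = (m(I := i)) J" for J j unfolding s_def by (auto simp: axis_def)
    note max_iff = gen_permutohedron_max_iff[OF y s]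
    let ?x = "\<Sum>J | J \<noteq> {}. y J *\<^sub>R s J"
    have "?x \<in> gen_permutohedron y" unfolding mem_gen_permutohedron using s by blast
    moreover have "\<forall>z\<in>gen_permutohedron y. h \<bullet> z \<le> h \<bullet> ?x"
      unfolding max_iff
    proof (intro allI impI)
      fix J j assume "J \<noteq> {}" "s J $ j \<noteq> 0"
      then show "j \<in> maximizers (($) h) J" using m'[of J] supp[of J j] by blast
    qed
    ultimately have "\<forall>z\<in>gen_permutohedron y. g \<bullet> z \<le> g \<bullet> ?x" using sub by blast
    then have "s I $ i \<noteq> 0 \<longrightarrow> i \<in> maximizers (($) g) I"
      unfolding max_iff using I by blast
    then show "i \<in> maximizers (($) g) I" using supp by simp
  qed
next
  assume R: ?R
  show "?F h \<subseteq> ?F g"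
  proof
    fix x assume x: "x \<in> ?F h"
    \<comment> \<open>One decomposition serves both functionals, since the criterion does not depend
      on its choice.\<close>
    then obtain s where s: "\<forall>I. I \<noteq> {} \<longrightarrow> s I \<in> coord_simplex I"
      and xs: "x = (\<Sum>I | I \<noteq> {}. y I *\<^sub>R s I)"
      unfolding mem_gen_permutohedron by blast
    have "\<forall>z\<in>gen_permutohedron y. h \<bullet> z \<le> h \<bullet> x" using x by simp
    then have "\<forall>z\<in>gen_permutohedron y. g \<bullet> z \<le> g \<bullet> x"
      unfolding xs gen_permutohedron_max_iff[OF y s] using R by blast
    then show "x \<in> ?F g" using x by simp
  qed
qed

theorem theorem7p4:
  fixes y :: "'n::finite set \<Rightarrow> real" and B :: "'n set set"
  assumes y_nonneg: "\<And>I. I \<noteq> {} \<Longrightarrow> y I \<ge> 0"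
    and B_eq: "B = {I. I \<noteq> {} \<and> y I > 0}"
    and building: "building_set UNIV B"
  shows "order_isomorphic (nonempty_faces (gen_permutohedron y)) (\<lambda>F G. G \<subseteq> F)
           (nested_complex B) (\<lambda>M N. M \<subseteq> N)"
proof -
  have y: "\<forall>I. I \<noteq> {} \<longrightarrow> y I \<ge> 0" using y_nonneg by blast
  let ?P = "gen_permutohedron y"
  let ?F = "\<lambda>h. {x \<in> ?P. \<forall>z\<in>?P. h \<bullet> z \<le> h \<bullet> x}"
  let ?N = "\<lambda>h. nested_of B (($) h)"
  \<comment> \<open>One vertex from each simplex gives a point, so the polytope is nonempty, as
    \<open>nonempty_faces_polytope\<close> requires.\<close>
  have "(\<Sum>I | I \<noteq> {}. y I *\<^sub>R axis (SOME i. i \<in> I) 1) \<in> ?P"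
    unfolding mem_gen_permutohedron
    by (intro exI[of _ "\<lambda>I. axis (SOME i. i \<in> I) 1"]) (auto intro: axis_in_coord_simplex some_in_eq[THEN iffD2])
  then have faces: "nonempty_faces ?P = range ?F"
    using nonempty_faces_polytope[OF polytope_gen_permutohedron] by blast
  \<comment> \<open>Nested sets are parametrised by arbitrary functions, faces by vectors; every
    function is the coordinate function of a vector, so vectors can index both.\<close>
  have "range (($) :: real^'n \<Rightarrow> _) = UNIV"
    by (metis surjI vec_lambda_inverse UNIV_I)
  then have nested: "nested_complex B = range ?N"
    unfolding nested_complex_eq_range[OF building] by (metis image_image)
  \<comment> \<open>Both inclusions become containment of \<open>maximizers\<close> over all
    \<open>I\<close> in \<open>B\<close>, that is, all nonempty \<open>I\<close> with
    \<open>y I > 0\<close>.\<close>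
  have "?F g \<subseteq> ?F h \<longleftrightarrow> ?N h \<subseteq> ?N g" for g h
    unfolding nested_of_subset_iff[OF building] gen_permutohedron_face_subset_iff[OF y]
    by (auto simp: B_eq)
  then show ?thesis unfolding faces nested by (intro order_isomorphic_range) auto
qed

end
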